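(* Let $Q$ be a simple cubic (i.e. $3$-regular) graph, bridgeless or not, let $\delta_3(Q)=\gamma_{\mathrm{ri},3}(S(Q))-|E(Q)|$, and let $d(Q)$ be the edge-colouring degree of $Q$, i.e. the minimum number of conflicting vertices in a $3$-edge-assignment, equivalently the minimum number of vertices at which incident colours are not pairwise distinct. Then $$\delta_3(Q)=d(Q).$$ In particular, since for every subcubic graph $G$ one has (a result of Fiol, Mazzuoccolo and Steffen) $$d(G)=r(G)=\rho(G),$$ it follows that for cubic $Q$ $$\delta_3(Q)=d(Q)=r(Q)=\rho(Q).$$ Weak oddness (denoted $\omega'(G)$ or $\omega_0(G)$, depending on notation) is a different parameter and does not generally coincide with these.
   Context: All graphs are finite, simple and undirected; a graph is subcubic if its maximum degree is at most $3$. Write $[3]=\{1,2,3\}$. A per-colour independent $3$-rainbow dominating function ($3$-RiDF) of a graph $G$ is a function $f:V(G)\to 2^{[3]}$ such that: (i) $|f(v)|\le 1$ for every $v$; (ii) for every $i\in[3]$ the set $V_i=\{v:f(v)=\{i\}\}$ is independent in $G$ (the union of the $V_i$ need not be independent); (iii) for every $v$ with $f(v)=\emptyset$, $\bigcup_{u\in N(v)}f(u)=[3]$, where $N(v)$ is the open neighbourhood. The weight of $f$ is $\sum_{v\in V(G)}|f(v)|$, and $\gamma_{\mathrm{ri},3}(G)$ is the minimum weight of a $3$-RiDF of $G$. The subdivision graph $S(Q)$ of a graph $Q$ has vertex set $V(Q)\cup E(Q)$ (disjoint union), with $a\in V(Q)$ adjacent to $e\in E(Q)$ exactly when $a$ is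 an endpoint of $e$, and no other edges. A $3$-edge-assignment of a graph $G$ is an arbitrary map $c:E(G)\to[3]$; a vertex is conflicting for $c$ if the colours of its incident edges are not pairwise distinct. The edge-colouring degree $d(G)$ is the minimum number of conflicting vertices over all $3$-edge-assignments of $G$. The resistance $r(G)$ is the minimum number of edges whose removal from $G$ yields a $3$-edge-colourable graph. $\rho(G)$ is the minimum number of vertices whose deletion from $G$ yields a $3$-edge-colourable graph. A graph is $3$-edge-colourable if it has a proper edge-colouring with at most $3$ colours. The weak oddness of a bridgeless cubic graph is, in the standard definition, the minimum number of components with an odd number of vertices in a spanning subgraph all of whose degrees are even (isolated vertices count as odd components). *)

theory Defs
  imports Main
begin

text \<open>
  A graph is a vertex set together with a set of edges, each edge being the set of its two ends;
  \<open>simple_graph\<close> carves out the finite simple undirected graphs.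
\<close>

datatype 'a ugraph = Graph (verts: "'a set") (edges: "'a set set")

definition simple_graph :: "'a ugraph \<Rightarrow> bool" where
  "simple_graph G \<longleftrightarrow> finite (verts G) \<and> (\<forall>e\<in>edges G. e \<subseteq> verts G \<and> card e = 2)"

definition neighbourhood :: "'a ugraph \<Rightarrow> 'a \<Rightarrow> 'a set" where
  "neighbourhood G v = {u \<in> verts G. {u, v} \<in> edges G}"

definition incident_edges :: "'a ugraph \<Rightarrow> 'a \<Rightarrow> 'a set set" where
  "incident_edges G v = {e \<in> edges G. v \<in> e}"

definition degree :: "'a ugraph \<Rightarrow> 'a \<Rightarrow> nat" where
  "degree G v = card (incident_edges G v)"

definition cubic :: "'a ugraph \<Rightarrow> bool" where
  "cubic G \<longleftrightarrow> (\<forall>v\<in>verts G. degree G v = 3)"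

definition subcubic :: "'a ugraph \<Rightarrow> bool" where
  "subcubic G \<longleftrightarrow> (\<forall>v\<in>verts G. degree G v \<le> 3)"

definition independent :: "'a ugraph \<Rightarrow> 'a set \<Rightarrow> bool" where
  "independent G S \<longleftrightarrow> S \<subseteq> verts G \<and> (\<forall>u\<in>S. \<forall>v\<in>S. {u, v} \<notin> edges G)"

definition delete_edges :: "'a ugraph \<Rightarrow> 'a set set \<Rightarrow> 'a ugraph" where
  "delete_edges G F = Graph (verts G) (edges G - F)"

definition delete_verts :: "'a ugraph \<Rightarrow> 'a set \<Rightarrow> 'a ugraph" where
  "delete_verts G W = Graph (verts G - W) {e \<in> edges G. e \<inter> W = {}}"

definition subdivision :: "'a ugraph \<Rightarrow> ('a + 'a set) ugraph" where
  "subdivision Q = Graph (Inl ` verts Q \<union> Inr ` edges Q)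
     {{Inl a, Inr e} | a e. a \<in> verts Q \<and> e \<in> edges Q \<and> a \<in> e}"


text \<open>
  The colour set is \<open>{1..3}\<close>. Colourings are total functions of which only the values on the
  vertices (respectively edges) of the graph matter. Each minimum below is a \<open>LEAST\<close> over a
  set of natural numbers that is nonempty for every finite simple graph.
\<close>

definition ridf3 :: "'a ugraph \<Rightarrow> ('a \<Rightarrow> nat set) \<Rightarrow> bool" where
  "ridf3 G f \<longleftrightarrow>
     (\<forall>v\<in>verts G. f v \<subseteq> {1..3}) \<and>
     (\<forall>v\<in>verts G. card (f v) \<le> 1) \<and>
     (\<forall>i\<in>{1..3}. independent G {v \<in> verts G. f v = {i}}) \<and>
     (\<forall>v\<in>verts G. f v = {} \<longrightarrow> (\<Union>u\<in>neighbourhood G v. f u) = {1..3})"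

definition ridf_weight :: "'a ugraph \<Rightarrow> ('a \<Rightarrow> nat set) \<Rightarrow> nat" where
  "ridf_weight G f = (\<Sum>v\<in>verts G. card (f v))"

definition gamma_ri3 :: "'a ugraph \<Rightarrow> nat" where
  "gamma_ri3 G = (LEAST k. \<exists>f. ridf3 G f \<and> ridf_weight G f = k)"

definition delta3 :: "'a ugraph \<Rightarrow> int" where
  "delta3 Q = int (gamma_ri3 (subdivision Q)) - int (card (edges Q))"

definition edge_assignment3 :: "'a ugraph \<Rightarrow> ('a set \<Rightarrow> nat) \<Rightarrow> bool" where
  "edge_assignment3 G c \<longleftrightarrow> (\<forall>e\<in>edges G. c e \<in> {1..3})"

definition conflicting :: "'a ugraph \<Rightarrow> ('a set \<Rightarrow> nat) \<Rightarrow> 'a \<Rightarrow> bool" where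
  "conflicting G c v \<longleftrightarrow> \<not> inj_on c (incident_edges G v)"

definition colouring_degree :: "'a ugraph \<Rightarrow> nat" where
  "colouring_degree G =
     (LEAST k. \<exists>c. edge_assignment3 G c \<and> card {v \<in> verts G. conflicting G c v} = k)"

definition edge_colourable3 :: "'a ugraph \<Rightarrow> bool" where
  "edge_colourable3 G \<longleftrightarrow>
     (\<exists>c :: 'a set \<Rightarrow> nat. (\<forall>e\<in>edges G. c e \<in> {1..3}) \<and>
        (\<forall>e\<in>edges G. \<forall>e'\<in>edges G. e \<noteq> e' \<and> e \<inter> e' \<noteq> {} \<longrightarrow> c e \<noteq> c e'))"

definition resistance :: "'a ugraph \<Rightarrow> nat" where
  "resistance G =
     (LEAST k. \<exists>F. F \<subseteq> edges G \<and> card F = k \<and> edge_colourable3 (delete_edges G F))"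

definition vertex_resistance :: "'a ugraph \<Rightarrow> nat" where
  "vertex_resistance G =
     (LEAST k. \<exists>W. W \<subseteq> verts G \<and> card W = k \<and> edge_colourable3 (delete_verts G W))"


definition connection :: "'a ugraph \<Rightarrow> ('a \<times> 'a) set" where
  "connection G = {(u, v). {u, v} \<in> edges G}\<^sup>* \<inter> verts G \<times> verts G"

definition components :: "'a ugraph \<Rightarrow> 'a set set" where
  "components G = verts G // connection G"

definition bridgeless :: "'a ugraph \<Rightarrow> bool" where
  "bridgeless G \<longleftrightarrow>
     (\<forall>e\<in>edges G. \<not> card (components G) < card (components (delete_edges G {e})))"

text \<open>
  Spanning subgraphs of \<open>G\<close> keep all vertices, so they are given by edge sets \<open>F\<close>; an isolated
  vertex of the subgraph is a component of size one and hence odd.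
\<close>

definition weak_oddness :: "'a ugraph \<Rightarrow> nat" where
  "weak_oddness G =
     (LEAST k. \<exists>F. F \<subseteq> edges G \<and> (\<forall>v\<in>verts G. even (degree (Graph (verts G) F) v)) \<and>
        card {C \<in> components (Graph (verts G) F). odd (card C)} = k)"

end

theory Submission
  imports Defs
begin

text \<open>
  In a rainbow dominating function of the subdivision of a cubic graph every edge vertex carries a
  colour, as its two neighbours cannot show three colours; an original vertex can be left empty
  exactly when its three edges have distinct colours, and otherwise a colour missing on its edges
  is free for it. This gives \<open>\<delta>\<^sub>3 = d\<close>.

  Further, \<open>d \<le> r\<close> because the deleted edges can be restored one by one, each at the cost of at
  most one conflicting vertex; \<open>\<rho> \<le> d\<close> because deleting the conflicting vertices leaves a proper
  colouring; and \<open>r \<le> \<rho>\<close> because after a Kempe switch a deleted vertex can be restored together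
  with all but one of its edges.

  The weak oddness of a cubic graph is even, since the number of vertices is. It therefore differs
  from \<open>d\<close> whenever \<open>d\<close> is odd. Replacing three vertices of the complete graph on four vertices by
  copies of the Petersen graph minus a vertex yields \<open>d = 3\<close>: each copy forces a conflict, and one
  conflict per copy suffices.
\<close>

section \<open>Proper colourings and Kempe chains\<close>

definition proper3 :: "'a set set \<Rightarrow> ('a set \<Rightarrow> nat) \<Rightarrow> bool" where
  "proper3 E c \<longleftrightarrow> (\<forall>e\<in>E. c e \<in> {1..3}) \<and>
     (\<forall>e\<in>E. \<forall>e'\<in>E. e \<noteq> e' \<and> e \<inter> e' \<noteq> {} \<longrightarrow> c e \<noteq> c e')"

abbreviation star :: "'a set set \<Rightarrow> 'a \<Rightarrow> 'a set set" where
  "star E v \<equiv> {e \<in> E. v \<in> e}"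

lemma proper3_iff:
  "proper3 E c \<longleftrightarrow> (\<forall>e\<in>E. c e \<in> {1..3}) \<and> (\<forall>v. inj_on c (star E v))"
  unfolding proper3_def inj_on_def by blast

lemma proper3D:
  assumes "proper3 E c" "e \<in> E" "e' \<in> E" "x \<in> e" "x \<in> e'" "c e = c e'"
  shows "e = e'"
  using assms by (auto simp: proper3_iff dest: inj_onD)

lemma edge_colourable3_iff: "edge_colourable3 G \<longleftrightarrow> (\<exists>c. proper3 (edges G) c)"
  by (simp add: edge_colourable3_def proper3_def)

lemma proper3_subset: "proper3 E c \<Longrightarrow> E' \<subseteq> E \<Longrightarrow> proper3 E' c"
  unfolding proper3_def by blast

definition missing :: "'a set set \<Rightarrow> ('a set \<Rightarrow> nat) \<Rightarrow> 'a \<Rightarrow> nat set" where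
  "missing E c v = {1..3} - c ` {e \<in> E. v \<in> e}"

lemma proper3_insert:
  assumes "proper3 E c" and "i \<in> missing E c u" and "i \<in> missing E c v"
  shows "proper3 (insert {u, v} E) (c({u, v} := i))"
  unfolding proper3_iff
proof (intro conjI ballI allI)
  let ?c = "c({u, v} := i)"
  show "?c e \<in> {1..3}" if "e \<in> insert {u, v} E" for e
    using that assms by (auto simp: proper3_iff missing_def)
  fix x
  \<comment> \<open>Leaving out \<open>{u, v}\<close> also covers the case that it already lies in
    \<open>E\<close> and is only recoloured.\<close>
  have inj: "inj_on ?c (star E x - {{u, v}})"
    using assms(1) by (auto simp: proper3_iff inj_on_def)
  show "inj_on ?c (star (insert {u, v} E) x)"
  proof (cases "x \<in> {u, v}")
    case True
    then have "i \<in> missing E c x" using assms by auto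
    then have "?c {u, v} \<notin> ?c ` (star E x - {{u, v}})" by (auto simp: missing_def)
    then have "inj_on ?c (insert {u, v} (star E x - {{u, v}}))"
      using inj unfolding inj_on_insert Diff_idemp by blast
    moreover have "star (insert {u, v} E) x = insert {u, v} (star E x - {{u, v}})"
      using True by auto
    ultimately show ?thesis by (simp only:)
  next
    case False
    then have "star (insert {u, v} E) x = star E x - {{u, v}}" by auto
    then show ?thesis using inj by (simp only:)
  qed
qed

lemma missing_upd:
  assumes "i \<in> missing E c v" "i \<noteq> j" "e \<notin> E"
  shows "i \<in> missing (insert e E) (c(e := j)) v"
  using assms unfolding missing_def by auto

lemma missing_nonempty:
  assumes "card {e \<in> E. v \<in> e} < 3" "finite {e \<in> E. v \<in> e}"
  shows "missing E c v \<noteq> {}"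
proof
  assume "missing E c v = {}"
  then have "{1..3} \<subseteq> c ` {e \<in> E. v \<in> e}" by (auto simp: missing_def)
  then have "card {1..3::nat} \<le> card (c ` {e \<in> E. v \<in> e})"
    using assms by (intro card_mono) auto
  also have "\<dots> \<le> card {e \<in> E. v \<in> e}" using assms by (intro card_image_le)
  finally show False using assms by simp
qed

text \<open>
  With \<open>s\<close> and \<open>t\<close> matching each vertex along its edge of the first and of the second colour, the
  walk below traverses the Kempe chain starting in \<open>a\<close>. Cutting it at the first visit to \<open>b\<close> or
  \<open>c\<close> leaves a closed set.
\<close>

lemma kempe_chain_closed_set:
  fixes s t :: "'a \<Rightarrow> 'a"
  assumes s: "\<And>x. s (s x) = x" and t: "\<And>x. t (t x) = x"
    and fp: "s a = a" "s b = b" "s c = c" and ne: "a \<noteq> b" "a \<noteq> c" "b \<noteq> c"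
  obtains T where "a \<in> T" "s ` T \<subseteq> T" "t ` T \<subseteq> T" "b \<notin> T \<or> c \<notin> T"
proof -
  \<comment> \<open>The walk starts with \<open>t\<close>, since \<open>s\<close> fixes its first
    vertex \<open>a\<close>. Applying an involution again leads one step back, which gives
    \<open>sy\<close> and \<open>ty\<close>.\<close>
  define y where "y = rec_nat a (\<lambda>k z. if even k then t z else s z)"
  have y0: "y 0 = a" and yS: "y (Suc k) = (if even k then t (y k) else s (y k))" for k
    by (simp_all add: y_def)
  have sy: "s (y k) = (if k = 0 then y 0 else if even k then y (k - 1) else y (Suc k))" for k
    by (cases k) (auto simp: y0 fp yS s)
  have ty: "t (y k) = (if even k then y (Suc k) else y (k - 1))" for k
    by (cases k) (auto simp: yS t)
  show thesis
  proof (cases "\<exists>i. y i \<in> {b, c}")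
    case False
    have "s ` range y \<subseteq> range y" "t ` range y \<subseteq> range y" by (auto simp: sy ty)
    moreover have "a \<in> range y" "b \<notin> range y" using rangeI[of y 0] y0 False by auto
    ultimately show thesis by (intro that[of "range y"]) auto
  next
    case True
    define i where "i = (LEAST i. y i \<in> {b, c})"
    have yi: "y i \<in> {b, c}" unfolding i_def by (rule LeastI_ex[OF True])
    have least: "y j \<notin> {b, c}" if "j < i" for j using that not_less_Least unfolding i_def by blast
    have i0: "i \<noteq> 0" using yi y0 ne by (intro notI) auto
    have syi: "s (y i) = y i" using yi fp by auto
    \<comment> \<open>A first visit at an even step would come from an application of
      \<open>s\<close>; as \<open>s\<close> fixes \<open>b\<close> and \<open>c\<close>, the
      previous vertex would be the same one, an earlier visit.\<close>
    have "odd i"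
    proof
      assume "even i"
      then have "y (i - 1) = y i" using sy[of i] syi i0 by simp
      then show False using least[of "i - 1"] yi i0 by simp
    qed
    have 1: "s (y j) \<in> y ` {..i}" if "j \<le> i" for j
    proof (cases "j = i")
      case False
      then show ?thesis using that sy[of j] by auto
    qed (use syi in simp)
    have 2: "t (y j) \<in> y ` {..i}" if "j \<le> i" for j
      using that \<open>odd i\<close> ty[of j] by (cases "j = i") auto
    \<comment> \<open>Only the last index reaches \<open>{b, c}\<close>, so at most one of the two
      is visited.\<close>
    have "b \<notin> y ` {..i} \<or> c \<notin> y ` {..i}"
    proof (rule ccontr)
      assume "\<not> ?thesis"
      then obtain j k where jk: "j \<le> i" "k \<le> i" "y j = b" "y k = c" by auto
      then have "j = i" "k = i" using least[of j] least[of k] by fastforce+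
      then show False using jk ne by simp
    qed
    then show thesis using 1 2 y0 by (intro that[of "y ` {..i}"]) auto
  qed
qed

text \<open>The default \<open>x\<close> makes this a total involution under a proper colouring,
  with every vertex that misses the colour as a fixed point: the form that
  \<open>kempe_chain_closed_set\<close> asks for.\<close>

definition partner :: "'a set set \<Rightarrow> ('a set \<Rightarrow> nat) \<Rightarrow> nat \<Rightarrow> 'a \<Rightarrow> 'a" where
  "partner E c i x = (if \<exists>y. {x, y} \<in> E \<and> c {x, y} = i then THE y. {x, y} \<in> E \<and> c {x, y} = i else x)"

lemma partner_eq:
  assumes "proper3 E c" "{x, y} \<in> E"  "c {x, y} = i"
  shows "partner E c i x = y"
proof -
  have eq: "z = y" if "{x, z} \<in> E" "c {x, z} = i" for z
  proof (rule ccontr)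
    assume "z \<noteq> y"
    then have "{x, z} \<noteq> {x, y}" by (auto simp: doubleton_eq_iff)
    then show False
      using proper3D[OF assms(1) that(1) assms(2), of x] assms(3) that(2) by simp
  qed
  have "(THE y. {x, y} \<in> E \<and> c {x, y} = i) = y"
    by (rule the_equality) (use assms(2,3) eq in blast)+
  moreover have "\<exists>y. {x, y} \<in> E \<and> c {x, y} = i" by (intro exI[of _ y] conjI assms(2,3))
  ultimately show ?thesis by (simp only: partner_def if_True)
qed

lemma partner_invol:
  assumes "proper3 E c"
  shows "partner E c i (partner E c i x) = x"
proof (cases "\<exists>y. {x, y} \<in> E \<and> c {x, y} = i")
  case True
  then obtain y where "{x, y} \<in> E" "c {x, y} = i" by blast
  then show ?thesis
    using partner_eq[OF assms, of x y i] partner_eq[OF assms, of y x i] by (simp add: insert_commute)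
next
  case False
  then have "partner E c i x = x" unfolding partner_def by argo
  then show ?thesis by simp
qed

lemma partner_missing:
  assumes "i \<in> missing E c x"
  shows "partner E c i x = x"
proof -
  have "c e \<noteq> i" if "e \<in> E" "x \<in> e" for e using assms that unfolding missing_def by blast
  then have "\<nexists>y. {x, y} \<in> E \<and> c {x, y} = i" by blast
  then show ?thesis by (simp only: partner_def if_False)
qed

text \<open>All three vertices miss \<open>i\<close>, so each can only be an end of its chain in the
  colours \<open>i\<close> and \<open>j\<close>. The chain from \<open>u\<close> has at most one
  further end, so it avoids \<open>v\<close> or \<open>w\<close>; switching colours along it frees
  \<open>j\<close> at \<open>u\<close>, while the avoided vertex keeps \<open>i\<close>
  free.\<close>

lemma kempe_swap:
  assumes c: "proper3 E c" and two: "\<And>e. e \<in> E \<Longrightarrow> card e = 2"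
    and ij: "i \<in> {1..3}" "j \<in> {1..3}" "i \<noteq> j"
    and miss: "i \<in> missing E c u" "i \<in> missing E c v" "i \<in> missing E c w"
    and ne: "u \<noteq> v" "u \<noteq> w" "v \<noteq> w"
  obtains c' where "proper3 E c'" "j \<in> missing E c' u"
    "i \<in> missing E c' v \<or> i \<in> missing E c' w"
proof -
  obtain T where T: "u \<in> T" "partner E c i ` T \<subseteq> T" "partner E c j ` T \<subseteq> T" "v \<notin> T \<or> w \<notin> T"
    by (rule kempe_chain_closed_set[OF partner_invol[OF c, where i = i] partner_invol[OF c, where i = j]
        partner_missing[OF miss(1)] partner_missing[OF miss(2)] partner_missing[OF miss(3)] ne])
  have sub: "e \<subseteq> T" if "e \<in> E" "c e \<in> {i, j}" "x \<in> e" "x \<in> T" for e x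
  proof -
    obtain y where e: "e = {x, y}" using two[OF \<open>e \<in> E\<close>] \<open>x \<in> e\<close> by (auto simp: card_2_iff)
    have "c {x, y} = i \<or> c {x, y} = j" using that(2) e by simp
    then have "y = partner E c i x \<or> y = partner E c j x"
      using partner_eq[OF c that(1)[unfolded e]] by metis
    then have "y \<in> T" using T(2,3) that(4) by blast
    then show ?thesis using that(4) e by simp
  qed
  define sw where "sw k = (if k = i then j else if k = j then i else k)" for k
  define c' where "c' e = (if e \<subseteq> T then sw (c e) else c e)" for e
  have sw: "sw k = sw l \<longleftrightarrow> k = l" "k \<notin> {i, j} \<Longrightarrow> sw k = k" for k l
    using ij by (auto simp: sw_def)
  \<comment> \<open>An edge that meets \<open>T\<close> but leaves it has the third colour, which
    \<open>sw\<close> fixes. So the switch describes all edges meeting \<open>T\<close>, and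
    properness can be checked at the common vertex.\<close>
  have c'T: "c' e = sw (c e)" if "e \<in> E" "x \<in> e" "x \<in> T" for e x
    using sub[OF that(1) _ that(2,3)] sw(2)[of "c e"] unfolding c'_def by metis
  have c'nT: "c' e = c e" if "x \<in> e" "x \<notin> T" for e x
    using that unfolding c'_def by auto
  have "proper3 E c'"
    unfolding proper3_def
  proof (intro conjI ballI impI)
    fix e assume "e \<in> E"
    then have "c e \<in> {1..3}" using c unfolding proper3_def by blast
    then show "c' e \<in> {1..3}" using ij(1,2) by (simp add: c'_def sw_def)
  next
    fix e e' assume e: "e \<in> E" "e' \<in> E" "e \<noteq> e' \<and> e \<inter> e' \<noteq> {}"
    then obtain x where x: "x \<in> e" "x \<in> e'" by auto
    have "c e \<noteq> c e'" using proper3D[OF c e(1,2) x] e(3) by blast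
    then show "c' e \<noteq> c' e'"
    proof (cases "x \<in> T")
      case True
      then show ?thesis
        using c'T[OF e(1) x(1) True] c'T[OF e(2) x(2) True] sw(1) \<open>c e \<noteq> c e'\<close> by simp
    next
      case False
      then show ?thesis using c'nT[OF x(1)] c'nT[OF x(2)] \<open>c e \<noteq> c e'\<close> by simp
    qed
  qed
  moreover have "j \<in> missing E c' u"
  proof -
    have "c' e \<noteq> j" if "e \<in> E" "u \<in> e" for e
    proof -
      have "c e \<noteq> i" using miss(1) that by (auto simp: missing_def)
      then show ?thesis using c'T[OF that T(1)] ij(3) by (auto simp: sw_def)
    qed
    then show ?thesis using ij(2) by (auto simp: missing_def)
  qed
  moreover have "i \<in> missing E c' z" if "z \<notin> T" "i \<in> missing E c z" for z
  proof -
    have "c' e = c e" if "e \<in> star E z" for e using c'nT that \<open>z \<notin> T\<close> by blast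
    then have "c' ` star E z = c ` star E z" by (intro image_cong) auto
    then show ?thesis using that by (simp add: missing_def)
  qed
  then have "i \<in> missing E c' v \<or> i \<in> missing E c' w" using T(4) miss by blast
  ultimately show thesis using that by blast
qed

section \<open>Resistance\<close>

text \<open>A deleted edge leaves at most two edges at its end \<open>u\<close>, so some colour is
  free there. Restoring the edge in that colour creates no conflict at \<open>u\<close>, and only
  \<open>v\<close> can become conflicting.\<close>

lemma assignment_of_deletion:
  assumes "finite F" and "F \<subseteq> E" and "finite E" and "\<And>e. e \<in> E \<Longrightarrow> card e = 2"
    and "\<And>v. card (star E v) \<le> 3" and "proper3 (E - F) c" and "finite V"
  shows "\<exists>c :: 'a set \<Rightarrow> nat. (\<forall>e\<in>E. c e \<in> {1..3}) \<and> card {v \<in> V. \<not> inj_on c (star E v)} \<le> card F"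
  using assms(1-6)
proof (induction F arbitrary: E rule: finite_induct)
  case empty
  then show ?case by (intro exI[of _ c]) (simp add: proper3_iff)
next
  case (insert e F)
  have E: "insert e (E - {e}) = E" "e \<in> E" using insert.prems by auto
  have sub: "star (E - {e}) v \<subseteq> star E v" and fin: "finite (star E v)" for v
    using insert.prems(2) by auto
  have IH: "\<exists>c :: 'a set \<Rightarrow> nat. (\<forall>e'\<in>E - {e}. c e' \<in> {1..3}) \<and>
      card {v \<in> V. \<not> inj_on c (star (E - {e}) v)} \<le> card F"
  proof (rule insert.IH)
    show "F \<subseteq> E - {e}" "finite (E - {e})" using insert.prems insert.hyps by blast+
    show "card e' = 2" if "e' \<in> E - {e}" for e' using insert.prems(3) that by blast
    show "card (star (E - {e}) v) \<le> 3" for v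
      using card_mono[OF fin sub, of v] insert.prems(4)[of v] by linarith
    have "E - {e} - F = E - insert e F" by blast
    then show "proper3 (E - {e} - F) c" using insert.prems(5) by simp
  qed
  then obtain c :: "'a set \<Rightarrow> nat" where c: "\<forall>e'\<in>E - {e}. c e' \<in> {1..3}"
      "card {v \<in> V. \<not> inj_on c (star (E - {e}) v)} \<le> card F"
    by blast
  obtain u v where e: "e = {u, v}" using insert.prems(3)[OF E(2)] by (auto simp: card_2_iff)
  have "missing (E - {e}) c u \<noteq> {}"
  proof (rule missing_nonempty)
    have "e \<in> star E u - star (E - {e}) u" using E(2) e by simp
    then have "star (E - {e}) u \<subset> star E u" by blast
    then have "card (star (E - {e}) u) < card (star E u)" by (rule psubset_card_mono[OF fin])
    then show "card (star (E - {e}) u) < 3" using insert.prems(4)[of u] by linarith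
    show "finite (star (E - {e}) u)" using finite_subset[OF sub fin] .
  qed
  then obtain i where i: "i \<in> missing (E - {e}) c u" by blast
  let ?c = "c(e := i)"
  have "inj_on ?c (star E x)" if "inj_on c (star (E - {e}) x)" "x \<noteq> v" for x
  proof (cases "x = u")
    case True
    have "star E u = insert e (star (E - {e}) u)" using E(2) e by blast
    moreover have "inj_on ?c (star (E - {e}) u)"
      using that True inj_on_cong[of "star (E - {e}) u" ?c c] by simp
    moreover have "?c e \<notin> ?c ` star (E - {e}) u" using i by (auto simp: missing_def)
    ultimately show ?thesis using True by simp
  next
    case False
    then have "star E x = star (E - {e}) x" using e that by blast
    then show ?thesis using that inj_on_cong[of "star (E - {e}) x" ?c c] by simp
  qed
  then have "{x \<in> V. \<not> inj_on ?c (star E x)} \<subseteq> insert v {x \<in> V. \<not> inj_on c (star (E - {e}) x)}"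
    by blast
  then have "card {x \<in> V. \<not> inj_on ?c (star E x)} \<le> card (insert v {x \<in> V. \<not> inj_on c (star (E - {e}) x)})"
    using \<open>finite V\<close> by (intro card_mono) auto
  also have "\<dots> \<le> Suc (card F)" using c(2) \<open>finite V\<close> by (simp add: card_insert_if)
  finally have "card {x \<in> V. \<not> inj_on ?c (star E x)} \<le> card (insert e F)" using insert.hyps by simp
  moreover have "\<forall>e'\<in>E. ?c e' \<in> {1..3}" using c(1) i by (auto simp: missing_def)
  ultimately show ?case by blast
qed

section \<open>Restoring a deleted vertex at the cost of one edge\<close>

lemma proper3_insert2:
  assumes c: "proper3 E c" and ij: "i \<in> missing E c a" "j \<in> missing E c b" "i \<noteq> j"
    and ne: "w \<noteq> a" "w \<noteq> b" "a \<noteq> b" and w: "star E w = {}"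
  shows "\<exists>c. proper3 (insert {w, a} (insert {w, b} E)) c"
proof -
  have "missing E c w = {1..3}" using w by (auto simp: missing_def)
  then have "i \<in> missing E c w" "j \<in> missing E c w" using ij by (auto simp: missing_def)
  moreover have "{w, b} \<notin> E" using w by auto
  ultimately have "proper3 (insert {w, b} E) (c({w, b} := j))"
    and "i \<in> missing (insert {w, b} E) (c({w, b} := j)) w"
    and "i \<in> missing (insert {w, b} E) (c({w, b} := j)) a"
    using proper3_insert[OF c] missing_upd[of i E c _ j] ij by auto
  from proper3_insert[OF this] show ?thesis by blast
qed

text \<open>Each neighbour of \<open>w\<close> has lost an edge and so has a free colour. If
  \<open>w\<close> has three neighbours and two of them have different free colours, both their
  edges return and the third stays deleted. If the three free colours agree,
  \<open>kempe_swap\<close> changes one of them and preserves another.\<close>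

lemma colourable_remove_edge_at:
  assumes fin: "finite E" and two: "\<And>e. e \<in> E \<Longrightarrow> card e = 2"
    and deg: "\<And>v. card (star E v) \<le> 3" and c: "proper3 (E - star E w) c"
  shows "\<exists>F c. F \<subseteq> E \<and> card F \<le> 1 \<and> proper3 (E - F) c"
proof -
  define K where "K = E - star E w"
  have K: "proper3 K c" "star K w = {}" "finite K" "\<And>e. e \<in> K \<Longrightarrow> card e = 2"
    using c fin two by (auto simp: K_def)
  have avail: "missing K c a \<noteq> {}" if "{w, a} \<in> E" for c a
  proof (rule missing_nonempty)
    have "{w, a} \<in> star E a - star K a" using that by (simp add: K_def)
    moreover have "star K a \<subseteq> star E a" by (auto simp: K_def)
    ultimately have "star K a \<subset> star E a" by blast
    then have "card (star K a) < card (star E a)" using fin by (intro psubset_card_mono) simp_all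
    then show "card (star K a) < 3" using deg[of a] by linarith
  qed (use K(3) in simp)
  have *: "?thesis" if "F \<subseteq> E" "card F \<le> 1" "proper3 K' c" "E - F \<subseteq> K'" for F K' c
    using that(1,2) proper3_subset[OF that(3,4)] by (intro exI conjI)
  have "finite (star E w)" using fin by simp
  have other: "\<exists>a. e = {w, a} \<and> w \<noteq> a" if "e \<in> star E w" for e
    using two[of e] that by (auto simp: card_2_iff)
  have "card (star E w) = 0 \<or> card (star E w) = 1 \<or> card (star E w) = 2 \<or> card (star E w) = 3"
    using deg[of w] by linarith
  then show ?thesis
  proof (elim disjE)
    assume "card (star E w) = 0"
    then have "E - {} \<subseteq> K" using \<open>finite (star E w)\<close> by (auto simp: K_def)
    then show ?thesis using *[OF _ _ K(1), of "{}"] by simp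
  next
    assume "card (star E w) = 1"
    then obtain e where e: "star E w = {e}" by (rule card_1_singletonE)
    then have "E - {e} \<subseteq> K" "{e} \<subseteq> E" by (auto simp: K_def)
    then show ?thesis using *[OF _ _ K(1), of "{e}"] by simp
  next
    assume "card (star E w) = 2"
    then obtain e f where 3: "star E w = {e, f}" by (meson card_2_iff)
    then obtain a where a: "e = {w, a}" using other[of e] by auto
    moreover have "e \<in> E" using 3 by auto
    ultimately obtain i where "i \<in> missing K c a" using avail by blast
    moreover have "i \<in> missing K c w" using K(2) calculation by (auto simp: missing_def)
    ultimately have "proper3 (insert e K) (c(e := i))" unfolding a by (intro proper3_insert K(1))
    moreover have "E - {f} \<subseteq> insert e K" "{f} \<subseteq> E" using 3 by (auto simp: K_def)
    ultimately show ?thesis using *[of "{f}" "insert e K"] by simp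
  next
    assume "card (star E w) = 3"
    then obtain e f g where 4: "star E w = {e, f, g}" "e \<noteq> f" "e \<noteq> g" "f \<noteq> g"
      by (auto simp only: card_3_iff)
    then obtain a b d where abd: "e = {w, a}" "f = {w, b}" "g = {w, d}" "w \<noteq> a" "w \<noteq> b" "w \<noteq> d"
      using other by (metis insertCI)
    have ne: "a \<noteq> b" "a \<noteq> d" "b \<noteq> d" using 4 abd by auto
    have inE: "e \<in> E" "f \<in> E" "g \<in> E" using 4 by auto
    have pair: ?thesis if "proper3 K c" "i \<in> missing K c x" "j \<in> missing K c y" "i \<noteq> j"
       "(x, y, h) \<in> {(a, b, g), (a, d, f), (b, d, e)}" for c i j x y h
    proof -
      have "\<exists>c. proper3 (insert {w, x} (insert {w, y} K)) c"
        using that abd ne K(2) by (intro proper3_insert2[of K c i x j y w]) auto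
      moreover have "E - {h} \<subseteq> insert {w, x} (insert {w, y} K)"
        using 4(1) that(5) abd by (auto simp: K_def)
      ultimately show ?thesis using *[of "{h}"] inE that(5) by auto
    qed
    obtain i j k where ijk: "i \<in> missing K c a" "j \<in> missing K c b" "k \<in> missing K c d"
      using avail inE abd by (metis ex_in_conv)
    show ?thesis
    proof (cases "i = j \<and> i = k")
      case False
      then show ?thesis using pair[OF K(1)] ijk by blast
    next
      case True
      have "i \<in> {1..3}" using ijk by (auto simp: missing_def)
      then obtain l where l: "l \<in> {1..3}" "i \<noteq> l" by (cases "i = 1") (auto intro: that[of 1] that[of 2])
      obtain c' where "proper3 K c'" "l \<in> missing K c' a" "i \<in> missing K c' b \<or> i \<in> missing K c' d"
        by (rule kempe_swap[OF K(1,4) \<open>i \<in> {1..3}\<close> l, of a b d]) (use ijk True ne in auto)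
      then show ?thesis using pair[of c' l _ i] l(2) by blast
    qed
  qed
qed

text \<open>Vertices return one by one: the induction hypothesis deals with \<open>E\<close> without
  the star of \<open>w\<close>, and \<open>colourable_remove_edge_at\<close> then restores what is
  left of that star up to one edge.\<close>

lemma edge_deletion_of_vertex_deletion:
  assumes "finite W" and "finite E" and "\<And>e. e \<in> E \<Longrightarrow> card e = 2"
    and "\<And>v. card (star E v) \<le> 3" and "proper3 {e \<in> E. e \<inter> W = {}} c"
  shows "\<exists>F c. F \<subseteq> E \<and> card F \<le> card W \<and> proper3 (E - F) c"
  using assms
proof (induction W arbitrary: E c rule: finite_induct)
  case empty
  then show ?case by (intro exI[of _ "{}"] exI[of _ c]) simp
next
  case (insert w W)
  let ?E = "E - star E w"
  have mono: "card (star E' v) \<le> 3" if "E' \<subseteq> E" for E' v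
  proof -
    have "star E' v \<subseteq> star E v" "finite (star E v)" using that insert.prems(1) by auto
    then show ?thesis using card_mono insert.prems(3)[of v] by (meson order.trans)
  qed
  have "{e \<in> ?E. e \<inter> W = {}} = {e \<in> E. e \<inter> insert w W = {}}" by auto
  then obtain F c' where F: "F \<subseteq> ?E" "card F \<le> card W" "proper3 (?E - F) c'"
    using insert.IH[of ?E c] insert.prems mono[of ?E] by auto
  have "E - F - star (E - F) w = ?E - F" by auto
  then obtain F' c'' where F': "F' \<subseteq> E - F" "card F' \<le> 1" "proper3 (E - F - F') c''"
    using colourable_remove_edge_at[of "E - F" w c'] insert.prems(1,2) mono[of "E - F"] F(3) by auto
  have "card (F \<union> F') \<le> card (insert w W)"
    using card_Un_le[of F F'] F F' insert.hyps by simp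
  moreover have "E - (F \<union> F') = E - F - F'" by blast
  moreover have "F \<union> F' \<subseteq> E" using F(1) F'(1) by blast
  ultimately show ?case using F'(3) by metis
qed

lemma finite_edges:
  assumes "simple_graph G"
  shows "finite (edges G)"
proof (rule finite_subset)
  show "edges G \<subseteq> Pow (verts G)" "finite (Pow (verts G))"
    using assms by (auto simp: simple_graph_def)
qed

text \<open>The parameters are compared in a cycle, colouring degree to resistance to vertex
  resistance and back, so three inequalities suffice.\<close>

lemma resistance_equalities:
  assumes "simple_graph G" and "subcubic G"
  shows "colouring_degree G = resistance G" and "resistance G = vertex_resistance G"
proof -
  have sub: "e \<subseteq> verts G" and two: "card e = 2" if "e \<in> edges G" for e
    using assms(1) that by (auto simp: simple_graph_def)
  have finV: "finite (verts G)" using assms(1) by (simp add: simple_graph_def)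
  have finE: "finite (edges G)" using assms(1) by (rule finite_edges)
  have deg: "card (star (edges G) v) \<le> 3" for v
  proof (cases "v \<in> verts G")
    case True
    then show ?thesis using assms(2) by (simp add: subcubic_def degree_def incident_edges_def)
  next
    case False
    then have "star (edges G) v = {}" using sub by auto
    then show ?thesis by (metis card.empty zero_le)
  qed
  \<comment> \<open>Deleting all edges shows that the minimum is over a nonempty set, so an optimal
    \<open>F\<close> exists.\<close>
  have "\<exists>k F. F \<subseteq> edges G \<and> card F = k \<and> edge_colourable3 (delete_edges G F)"
    by (intro exI[of _ "card (edges G)"] exI[of _ "edges G"])
      (simp add: edge_colourable3_def delete_edges_def)
  from LeastI_ex[OF this] obtain F c where F: "F \<subseteq> edges G" "card F = resistance G"
      "proper3 (edges G - F) c"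
    by (auto simp: resistance_def edge_colourable3_iff delete_edges_def)
  have "colouring_degree G \<le> resistance G"
  proof -
    obtain c :: "'a set \<Rightarrow> nat" where c: "\<forall>e\<in>edges G. c e \<in> {1..3}"
      "card {v \<in> verts G. \<not> inj_on c (star (edges G) v)} \<le> card F"
      using assignment_of_deletion[OF finite_subset[OF F(1) finE] F(1) finE two deg F(3) finV] by auto
    then have "colouring_degree G \<le> card {v \<in> verts G. conflicting G c v}"
      unfolding colouring_degree_def by (intro Least_le) (auto simp: edge_assignment3_def)
    then show ?thesis using c F(2) by (simp add: conflicting_def incident_edges_def)
  qed
  moreover have "resistance G \<le> vertex_resistance G"
  proof -
    have "\<exists>k W. W \<subseteq> verts G \<and> card W = k \<and> edge_colourable3 (delete_verts G W)"
    proof (intro exI conjI)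
      have "e \<inter> verts G \<noteq> {}" if "e \<in> edges G" for e
        using sub[OF that] two[OF that] by (auto simp: Int_absorb2)
      then have "edges (delete_verts G (verts G)) = {}" by (simp add: delete_verts_def)
      then show "edge_colourable3 (delete_verts G (verts G))"
        by (simp add: edge_colourable3_iff proper3_def)
    qed auto
    from LeastI_ex[OF this] obtain W c where W: "W \<subseteq> verts G" "card W = vertex_resistance G"
      "proper3 {e \<in> edges G. e \<inter> W = {}} c"
      by (auto simp: vertex_resistance_def edge_colourable3_iff delete_verts_def)
    obtain F c where "F \<subseteq> edges G" "card F \<le> card W" "proper3 (edges G - F) c"
      using edge_deletion_of_vertex_deletion[OF finite_subset[OF W(1) finV] finE two deg W(3)] by auto
    moreover from this have "resistance G \<le> card F"
      unfolding resistance_def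
      by (intro Least_le) (auto simp: edge_colourable3_iff delete_edges_def)
    ultimately show ?thesis using W(2) by simp
  qed
  moreover have "vertex_resistance G \<le> colouring_degree G"
  proof -
    have "\<exists>k c. edge_assignment3 G c \<and> card {v \<in> verts G. conflicting G c v} = k"
      by (auto simp: edge_assignment3_def intro!: exI[of _ "\<lambda>_. 1"])
    from LeastI_ex[OF this] obtain c where c: "edge_assignment3 G c"
      "card {v \<in> verts G. conflicting G c v} = colouring_degree G"
      by (auto simp: colouring_degree_def)
    let ?W = "{v \<in> verts G. conflicting G c v}"
    \<comment> \<open>Two remaining edges can only meet in a vertex outside \<open>?W\<close>, where
      \<open>c\<close> is injective on the full star.\<close>
    have "proper3 {e \<in> edges G. e \<inter> ?W = {}} c"
      unfolding proper3_def
    proof (intro conjI ballI impI)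
      fix e e' assume e: "e \<in> {e \<in> edges G. e \<inter> ?W = {}}" "e' \<in> {e \<in> edges G. e \<inter> ?W = {}}"
        "e \<noteq> e' \<and> e \<inter> e' \<noteq> {}"
      then obtain v where v: "v \<in> e" "v \<in> e'" by blast
      then have "v \<in> verts G" using sub e by blast
      then have "inj_on c (star (edges G) v)"
        using e v by (auto simp: conflicting_def incident_edges_def)
      then show "c e \<noteq> c e'" using e v by (auto dest: inj_onD)
    qed (use c in \<open>auto simp: edge_assignment3_def\<close>)
    then have "edge_colourable3 (delete_verts G ?W)"
      by (auto simp: edge_colourable3_iff delete_verts_def)
    then show ?thesis unfolding vertex_resistance_def c(2)[symmetric]
      by (intro Least_le exI[of _ ?W]) auto
  qed
  ultimately show "colouring_degree G = resistance G" "resistance G = vertex_resistance G" by auto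
qed

section \<open>Rainbow domination of the subdivision graph\<close>

lemma subdivision_edge_iff:
  "{Inl a, Inr e} \<in> edges (subdivision Q) \<longleftrightarrow> a \<in> verts Q \<and> e \<in> edges Q \<and> a \<in> e"
  by (auto simp: subdivision_def doubleton_eq_iff)

lemma subdivision_no_edge:
  "{Inl a, Inl b} \<notin> edges (subdivision Q)" "{Inr e, Inr e'} \<notin> edges (subdivision Q)"
  by (auto simp: subdivision_def doubleton_eq_iff)

lemma subdivision_edge_iff':
  "{Inr e, Inl a} \<in> edges (subdivision Q) \<longleftrightarrow> a \<in> verts Q \<and> e \<in> edges Q \<and> a \<in> e"
  using subdivision_edge_iff[of a e Q] by (simp add: insert_commute)

lemma verts_subdivision: "verts (subdivision Q) = Inl ` verts Q \<union> Inr ` edges Q"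
  by (simp add: subdivision_def)

lemma neighbourhood_subdivision_Inl:
  assumes "a \<in> verts Q"
  shows "neighbourhood (subdivision Q) (Inl a) = Inr ` incident_edges Q a"
proof (rule set_eqI)
  fix x
  show "x \<in> neighbourhood (subdivision Q) (Inl a) \<longleftrightarrow> x \<in> Inr ` incident_edges Q a"
    using assms
    by (cases x) (auto simp: neighbourhood_def incident_edges_def verts_subdivision
        subdivision_edge_iff' subdivision_no_edge)
qed

lemma neighbourhood_subdivision_Inr:
  assumes "e \<in> edges Q" and "e \<subseteq> verts Q"
  shows "neighbourhood (subdivision Q) (Inr e) = Inl ` e"
proof (rule set_eqI)
  fix x
  show "x \<in> neighbourhood (subdivision Q) (Inr e) \<longleftrightarrow> x \<in> Inl ` e"
    using assms
    by (cases x) (auto simp: neighbourhood_def verts_subdivision subdivision_edge_iff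
        subdivision_no_edge)
qed

lemma ridf_weight_subdivision:
  assumes "finite (verts Q)" and "finite (edges Q)"
  shows "ridf_weight (subdivision Q) f =
    (\<Sum>a\<in>verts Q. card (f (Inl a))) + (\<Sum>e\<in>edges Q. card (f (Inr e)))"
proof -
  have "Inl ` verts Q \<inter> Inr ` edges Q = {}" by auto
  then show ?thesis using assms
    by (simp add: ridf_weight_def verts_subdivision sum.union_disjoint sum.reindex comp_def)
qed

lemma card_Union_le_2:
  assumes "card e = 2" and "\<And>a. a \<in> e \<Longrightarrow> card (g a) \<le> 1"
  shows "card (\<Union>a\<in>e. g a) \<le> 2"
proof -
  have "finite e" using assms(1) card.infinite by fastforce
  then have "card (\<Union>a\<in>e. g a) \<le> (\<Sum>a\<in>e. card (g a))" by (rule card_UN_le)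
  also have "\<dots> \<le> 2" using sum_bounded_above[of e "\<lambda>a. card (g a)" 1] assms by simp
  finally show ?thesis .
qed

text \<open>Functions and assignments correspond through the colours on the edge vertices:
  \<open>upper\<close> builds a function whose weight is the number of edges plus the number of
  conflicts, and \<open>lower\<close> reads off an assignment whose conflicts are paid for by
  coloured original vertices.\<close>

lemma delta3_eq_colouring_degree:
  assumes Q: "simple_graph Q" "cubic Q"
  shows "delta3 Q = int (colouring_degree Q)"
proof -
  let ?S = "subdivision Q"
  have fin: "finite (verts Q)" "finite (edges Q)"
    using Q finite_edges by (auto simp: simple_graph_def)
  have two: "card e = 2" and sub: "e \<subseteq> verts Q" if "e \<in> edges Q" for e
    using Q that by (auto simp: simple_graph_def)
  have deg: "card (incident_edges Q v) = 3" if "v \<in> verts Q" for v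
    using Q that by (auto simp: cubic_def degree_def)
  have finI: "finite (incident_edges Q v)" for v using fin by (simp add: incident_edges_def)
  have upper: "\<exists>f. ridf3 ?S f \<and>
      ridf_weight ?S f = card (edges Q) + card {v \<in> verts Q. conflicting Q c v}"
    if c: "edge_assignment3 Q c" for c
  proof -
    have cr: "c e \<in> {1..3}" if "e \<in> edges Q" for e using c that by (simp add: edge_assignment3_def)
    \<comment> \<open>Three edges with a repeated colour show at most two colours.\<close>
    have "\<exists>i\<in>{1..3}. i \<notin> c ` incident_edges Q a" if "a \<in> verts Q" "conflicting Q c a" for a
    proof (rule ccontr)
      assume "\<not> ?thesis"
      then have "{1..3} \<subseteq> c ` incident_edges Q a" by blast
      then have "card {1..3::nat} \<le> card (c ` incident_edges Q a)"
        using finI by (intro card_mono) auto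
      then have "card (c ` incident_edges Q a) = card (incident_edges Q a)"
        using deg[OF that(1)] card_image_le[OF finI, of c a] by simp
      then show False using that finI by (simp add: conflicting_def eq_card_imp_inj_on)
    qed
    then obtain m where m: "m a \<in> {1..3}" "m a \<notin> c ` incident_edges Q a"
      if "a \<in> verts Q" "conflicting Q c a" for a
      by metis
    \<comment> \<open>Since \<open>m a\<close> is absent from the edges at \<open>a\<close>, no edge
      of the subdivision joins equal colours.\<close>
    define f where "f = case_sum (\<lambda>a. if conflicting Q c a then {m a} else {}) (\<lambda>e. {c e})"
    have fl: "f (Inl a) = (if conflicting Q c a then {m a} else {})" and fr: "f (Inr e) = {c e}" for a e
      by (simp_all add: f_def)
    have "ridf3 ?S f"
      unfolding ridf3_def
    proof (intro conjI ballI impI)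
      fix x assume "x \<in> verts ?S"
      then show "f x \<subseteq> {1..3}" "card (f x) \<le> 1"
        using m(1) cr by (auto simp: verts_subdivision fl fr split: if_splits)
    next
      fix i :: nat
      have "\<not> (f (Inl a) = {i} \<and> f (Inr e) = {i})" if "{Inl a, Inr e} \<in> edges ?S" for a e
      proof -
        have "a \<in> verts Q" "e \<in> incident_edges Q a"
          using that by (auto simp: subdivision_edge_iff incident_edges_def)
        then have "m a \<noteq> c e" if "conflicting Q c a" using m(2)[OF _ that] by blast
        then show ?thesis by (auto simp: fl fr split: if_splits)
      qed
      note * = this
      have "{x, y} \<notin> edges ?S" if "f x = {i}" "f y = {i}" for x y
      proof (cases x; cases y)
        fix a e assume "x = Inl a" "y = Inr e"
        then show ?thesis using that *[of a e] by auto
      next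
        fix a e assume "x = Inr e" "y = Inl a"
        then show ?thesis using that *[of a e] by (auto simp: insert_commute)
      qed (auto simp: subdivision_no_edge)
      then show "independent ?S {v \<in> verts ?S. f v = {i}}"
        by (auto simp: independent_def)
    next
      fix x assume x: "x \<in> verts ?S" "f x = {}"
      then obtain a where a: "x = Inl a" "a \<in> verts Q" "\<not> conflicting Q c a"
        by (auto simp: verts_subdivision fl fr split: if_splits)
      have "c ` incident_edges Q a = {1..3}"
      proof (rule card_subset_eq)
        show "c ` incident_edges Q a \<subseteq> {1..3}" using cr by (auto simp: incident_edges_def)
        show "card (c ` incident_edges Q a) = card {1..3::nat}"
          using a deg by (simp add: conflicting_def card_image)
      qed simp
      then show "(\<Union>u\<in>neighbourhood ?S x. f u) = {1..3}"
        using a by (simp add: neighbourhood_subdivision_Inl fr image_image[symmetric] UNION_singleton_eq_range)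
    qed
    moreover have "(\<Sum>a\<in>verts Q. card (f (Inl a))) = card {v \<in> verts Q. conflicting Q c v}"
    proof -
      have "(\<Sum>a\<in>verts Q. card (f (Inl a))) = (\<Sum>a\<in>verts Q. if conflicting Q c a then 1 else 0)"
        by (intro sum.cong) (auto simp: fl)
      then show ?thesis using fin by (simp add: sum.If_cases Int_def)
    qed
    ultimately show ?thesis using fin by (auto simp: ridf_weight_subdivision fr intro!: exI[of _ f])
  qed
  have lower: "\<exists>c. edge_assignment3 Q c \<and>
      card (edges Q) + card {v \<in> verts Q. conflicting Q c v} \<le> ridf_weight ?S f"
    if f: "ridf3 ?S f" for f
  proof -
    have fsub: "f x \<subseteq> {1..3}" and fcard: "card (f x) \<le> 1"
      and fdom: "f x = {} \<Longrightarrow> (\<Union>u\<in>neighbourhood ?S x. f u) = {1..3}" if "x \<in> verts ?S" for x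
      using f that by (auto simp: ridf3_def)
    have ffin: "finite (f x)" if "x \<in> verts ?S" for x using fsub[OF that] finite_subset by blast
    have fe: "card (f (Inr e)) = 1" if e: "e \<in> edges Q" for e
    proof -
      have "f (Inr e) \<noteq> {}"
      proof
        assume "f (Inr e) = {}"
        then have "(\<Union>a\<in>e. f (Inl a)) = {1..3}"
          using fdom[of "Inr e"] e sub[OF e]
          by (simp add: verts_subdivision neighbourhood_subdivision_Inr)
        moreover have "card (\<Union>a\<in>e. f (Inl a)) \<le> 2"
          using two[OF e] sub[OF e] fcard by (intro card_Union_le_2) (auto simp: verts_subdivision)
        ultimately show False by simp
      qed
      then show ?thesis using fcard[of "Inr e"] ffin[of "Inr e"] e
        by (metis One_nat_def UnI2 card_0_eq imageI le_SucE le_zero_eq verts_subdivision)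
    qed
    define c where "c e = the_elem (f (Inr e))" for e
    have c: "f (Inr e) = {c e}" if "e \<in> edges Q" for e
      using card_1_singletonE[OF fe[OF that]] by (metis c_def the_elem_eq)
    have "edge_assignment3 Q c"
      unfolding edge_assignment3_def
    proof
      fix e assume "e \<in> edges Q"
      then show "c e \<in> {1..3}" using fsub[of "Inr e"] c[of e] by (auto simp: verts_subdivision)
    qed
    \<comment> \<open>If \<open>a\<close> were empty, its three edges would have to show three
      colours, hence be free of conflict.\<close>
    moreover have conf: "card (f (Inl a)) = 1" if a: "a \<in> verts Q" "conflicting Q c a" for a
    proof -
      have "f (Inl a) \<noteq> {}"
      proof
        assume "f (Inl a) = {}"
        then have "(\<Union>e\<in>incident_edges Q a. f (Inr e)) = {1..3}"
          using fdom[of "Inl a"] a by (simp add: verts_subdivision neighbourhood_subdivision_Inl)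
        moreover have "(\<Union>e\<in>incident_edges Q a. f (Inr e)) = c ` incident_edges Q a"
          using c by (auto simp: incident_edges_def)
        ultimately have "card (c ` incident_edges Q a) = card (incident_edges Q a)"
          using deg a by simp
        then show False using a finI by (simp add: conflicting_def eq_card_imp_inj_on)
      qed
      then show ?thesis using fcard[of "Inl a"] ffin[of "Inl a"] a
        by (metis One_nat_def UnI1 card_0_eq imageI le_SucE le_zero_eq verts_subdivision)
    qed
    moreover have "card {v \<in> verts Q. conflicting Q c v} \<le> (\<Sum>a\<in>verts Q. card (f (Inl a)))"
    proof -
      have "card {v \<in> verts Q. conflicting Q c v} = (\<Sum>a\<in>{v \<in> verts Q. conflicting Q c v}. card (f (Inl a)))"
        using conf by simp
      also have "\<dots> \<le> (\<Sum>a\<in>verts Q. card (f (Inl a)))" using fin by (intro sum_mono2) auto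
      finally show ?thesis .
    qed
    ultimately show ?thesis using fe fin by (auto simp: ridf_weight_subdivision intro!: exI[of _ c])
  qed
  have "\<exists>k c. edge_assignment3 Q c \<and> card {v \<in> verts Q. conflicting Q c v} = k"
    by (auto simp: edge_assignment3_def intro!: exI[of _ "\<lambda>_. 1"])
  from LeastI_ex[OF this] obtain c where c: "edge_assignment3 Q c"
    "card {v \<in> verts Q. conflicting Q c v} = colouring_degree Q"
    by (auto simp: colouring_degree_def)
  from upper[OF c(1)] obtain f where f: "ridf3 ?S f"
    "ridf_weight ?S f = card (edges Q) + colouring_degree Q" using c(2) by auto
  have "gamma_ri3 ?S = card (edges Q) + colouring_degree Q"
    unfolding gamma_ri3_def
  proof (rule Least_equality)
    fix k assume "\<exists>f. ridf3 ?S f \<and> ridf_weight ?S f = k"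
    then obtain c' where c': "edge_assignment3 Q c'"
        "card (edges Q) + card {v \<in> verts Q. conflicting Q c' v} \<le> k"
      using lower by blast
    have "colouring_degree Q \<le> card {v \<in> verts Q. conflicting Q c' v}"
      unfolding colouring_degree_def using c'(1) by (intro Least_le) auto
    then show "card (edges Q) + colouring_degree Q \<le> k" using c'(2) by simp
  qed (use f in auto)
  then show ?thesis by (simp add: delta3_def)
qed

section \<open>Weak oddness\<close>

lemma components_partition:
  assumes "\<And>e. e \<in> edges G \<Longrightarrow> e \<subseteq> verts G"
  shows "\<Union> (components G) = verts G" and "pairwise disjnt (components G)"
proof -
  let ?R = "{(u, v). {u, v} \<in> edges G}"
  have "sym ?R" by (auto simp: sym_def insert_commute)
  then have "equiv (verts G) (connection G)"
    unfolding connection_def equiv_def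
    by (auto simp: refl_on_def sym_def trans_def intro: symD[OF sym_rtrancl] rtrancl_trans)
  note equiv = this
  show "\<Union> (components G) = verts G"
    unfolding components_def by (rule Union_quotient[OF equiv])
  show "pairwise disjnt (components G)"
    unfolding components_def pairwise_def disjnt_def using quotient_disj[OF equiv] by blast
qed

text \<open>The components of a spanning subgraph partition the vertex set, so the number of odd
  ones has the parity of the number of vertices.\<close>

lemma even_weak_oddness:
  assumes "simple_graph G" and "even (card (verts G))"
  shows "even (weak_oddness G)"
proof -
  have "\<exists>k F. F \<subseteq> edges G \<and> (\<forall>v\<in>verts G. even (degree (Graph (verts G) F) v)) \<and>
      card {C \<in> components (Graph (verts G) F). odd (card C)} = k"
    by (intro exI[of _ "{}"] exI) (auto simp: degree_def incident_edges_def)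
  from LeastI_ex[OF this] obtain F where F: "F \<subseteq> edges G"
    "card {C \<in> components (Graph (verts G) F). odd (card C)} = weak_oddness G"
    by (auto simp: weak_oddness_def)
  let ?C = "components (Graph (verts G) F)"
  have "e \<subseteq> verts G" if "e \<in> F" for e
    using assms(1) F(1) that by (auto simp: simple_graph_def)
  then have C: "\<Union> ?C = verts G" "pairwise disjnt ?C"
    using components_partition[of "Graph (verts G) F"] by auto
  have fin: "finite (verts G)" using assms(1) by (simp add: simple_graph_def)
  have "finite ?C" "\<And>X. X \<in> ?C \<Longrightarrow> finite X"
    using C(1) fin by (auto intro: finite_UnionD finite_subset)
  then have "card (verts G) = (\<Sum>X\<in>?C. card X)"
    using card_Union_disjoint[of ?C] C by simp
  then have "even (card {X \<in> ?C. odd (card X)})"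
    using assms(2) even_sum_iff[OF \<open>finite ?C\<close>, of card] by simp
  then show ?thesis using F(2) by simp
qed

text \<open>If the ends of an edge stay connected without it, deleting it leaves reachability, and
  with it the set of components, unchanged.\<close>

lemma bridgelessI:
  assumes "\<And>e. e \<in> edges G \<Longrightarrow>
    \<exists>u v. e = {u, v} \<and> (u, v) \<in> {(x, y). {x, y} \<in> edges G - {e}}\<^sup>*"
  shows "bridgeless G"
  unfolding bridgeless_def
proof
  fix e assume "e \<in> edges G"
  let ?R = "{(x, y). {x, y} \<in> edges G}" and ?R' = "{(x, y). {x, y} \<in> edges G - {e}}"
  obtain u v where e: "e = {u, v}" "(u, v) \<in> ?R'\<^sup>*" using assms[OF \<open>e \<in> edges G\<close>] by blast
  have "sym ?R'" by (auto simp: sym_def insert_commute)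
  then have vu: "(v, u) \<in> ?R'\<^sup>*" using e(2) by (meson sym_rtrancl symD)
  have "(x, y) \<in> ?R'\<^sup>*" if "{x, y} \<in> edges G" for x y
  proof (cases "{x, y} = e")
    case True
    then show ?thesis using e vu by (auto simp: doubleton_eq_iff)
  next
    case False
    then show ?thesis using that by (intro r_into_rtrancl) simp
  qed
  then have "?R \<subseteq> ?R'\<^sup>*" by auto
  moreover have "?R' \<subseteq> ?R" by auto
  ultimately have "?R\<^sup>* = ?R'\<^sup>*" by (intro rtrancl_subset)
  then have "components (delete_edges G {e}) = components G"
    by (simp add: components_def connection_def delete_edges_def)
  then show "\<not> card (components G) < card (components (delete_edges G {e}))" by simp
qed

lemma successively_rtrancl:
  assumes "successively R xs" and "xs \<noteq> []"
  shows "(hd xs, last xs) \<in> {(x, y). R x y}\<^sup>*"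
  using assms
  by (induction R xs rule: successively.induct) (auto intro: converse_rtrancl_into_rtrancl)

section \<open>Three Petersen graphs inserted into the complete graph on four vertices\<close>

text \<open>
  Vertex \<open>27\<close> and the three copies of the Petersen graph minus a vertex, on \<open>{k..<k + 9}\<close> for
  \<open>k = 0, 9, 18\<close>, are arranged as the vertices of the complete graph. In each copy \<open>k, \<dots>, k + 4\<close> is
  the outer pentagon and \<open>k + 5, \<dots>, k + 8\<close> are inner vertices. The ends of the deleted spoke and
  inner edges are \<open>k + 4\<close>, joined to \<open>27\<close>, and \<open>k + 6\<close>, \<open>k + 7\<close>, joined to the next and
  the previous copy. Indices other than \<open>27\<close> are taken modulo \<open>27\<close>.
\<close>

definition pk4_shift :: "nat \<Rightarrow> nat \<Rightarrow> nat" where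
  "pk4_shift k v = (if v = 27 then 27 else (k + v) mod 27)"

definition pk4_nbrs :: "nat \<Rightarrow> nat list" where
  "pk4_nbrs v = (if v = 27 then [4, 13, 22] else map (pk4_shift (9 * (v div 9)))
     ([[1, 4, 5], [0, 2, 6], [1, 3, 7], [2, 4, 8], [0, 3, 27], [0, 7, 8], [1, 8, 16], [2, 5, 24],
       [3, 5, 6]] ! (v mod 9)))"

definition pk4 :: "nat ugraph" where
  "pk4 = Graph {..<28} {{u, v} | u v. u < 28 \<and> v \<in> set (pk4_nbrs u)}"

text \<open>The colour table runs parallel to the neighbour lists. Colours rotate cyclically from
  copy to copy, which gives the three edges at \<open>27\<close> distinct colours; in each copy only
  the first vertex, with three equal colours, is conflicting.\<close>

definition pk4_col :: "nat \<Rightarrow> nat \<Rightarrow> nat" where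
  "pk4_col u v = the (map_of (zip (pk4_nbrs u) (if u = 27 then [2, 3, 1]
     else map (\<lambda>i. Suc ((u div 9 + i) mod 3)) ([[0, 0, 0], [0, 1, 2], [1, 0, 2], [0, 2, 1], [0, 2, 1],
       [0, 1, 2], [2, 0, 1], [2, 1, 0], [1, 2, 0]] ! (u mod 9)))) v)"

text \<open>The images of this cycle under rotation of the copies cover all edges.\<close>

definition pk4_cycle :: "nat list" where
  "pk4_cycle = [7, 2, 1, 6, 16, 14, 17, 12, 11, 10, 9, 13, 27, 22, 21, 20, 19, 18, 23, 26, 24]"

section \<open>Finite checks on the example\<close>

lemma less_28:
  "u < 28 \<longleftrightarrow> u \<in> {0, 1, 2, 3, 4, 5, 6, 7, 8, 9, 10, 11, 12, 13, 14, 15, 16, 17, 18, 19, 20, 21,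
     22, 23, 24, 25, 26, 27}" for u :: nat
  by (simp only: insert_iff empty_iff) presburger

text \<open>Spelling out the quantifier lets the simplifier evaluate the tables vertex by
  vertex.\<close>

lemma all_less_28:
  "(\<forall>u<28. P u) \<longleftrightarrow> P 0 \<and> P 1 \<and> P 2 \<and> P 3 \<and> P 4 \<and> P 5 \<and> P 6 \<and> P 7 \<and> P 8 \<and> P 9 \<and> P 10 \<and> P 11 \<and>
     P 12 \<and> P 13 \<and> P 14 \<and> P 15 \<and> P 16 \<and> P 17 \<and> P 18 \<and> P 19 \<and> P 20 \<and> P 21 \<and> P 22 \<and> P 23 \<and>
     P 24 \<and> P 25 \<and> P 26 \<and> P 27" for P :: "nat \<Rightarrow> bool"
  unfolding less_28 by blast

lemma pk4_nbrs_check: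
  assumes "u < 28"
  shows "distinct (pk4_nbrs u) \<and> length (pk4_nbrs u) = 3 \<and>
     (\<forall>v\<in>set (pk4_nbrs u). v < 28 \<and> v \<noteq> u \<and> u \<in> set (pk4_nbrs v))"
proof -
  have "\<forall>u<28. distinct (pk4_nbrs u) \<and> length (pk4_nbrs u) = 3 \<and>
     (\<forall>v\<in>set (pk4_nbrs u). v < 28 \<and> v \<noteq> u \<and> u \<in> set (pk4_nbrs v))"
    unfolding all_less_28 by (simp add: pk4_nbrs_def pk4_shift_def)
  then show ?thesis using assms by blast
qed

lemma pk4_col_check:
  assumes "u < 28"
  shows "(\<forall>v\<in>set (pk4_nbrs u). pk4_col u v = pk4_col v u \<and> pk4_col u v \<in> {1..3}) \<and>
     (distinct (map (pk4_col u) (pk4_nbrs u)) \<or> u \<in> {0, 9, 18})"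
proof -
  have "\<forall>u<28.
     (\<forall>v\<in>set (pk4_nbrs u). pk4_col u v = pk4_col v u \<and> pk4_col u v \<in> {1..3}) \<and>
     (distinct (map (pk4_col u) (pk4_nbrs u)) \<or> u \<in> {0, 9, 18})"
    unfolding all_less_28 by (simp add: pk4_nbrs_def pk4_shift_def pk4_col_def)
  then show ?thesis using assms by blast
qed

text \<open>The length bound excludes an edge walked back and forth, which would give no
  detour.\<close>

definition cycle_in :: "'a set set \<Rightarrow> 'a list \<Rightarrow> bool" where
  "cycle_in E xs \<longleftrightarrow> distinct xs \<and> 3 \<le> length xs \<and>
     successively (\<lambda>x y. {x, y} \<in> E) (xs @ [hd xs])"

lemma pk4_edge_iff: "{u, v} \<in> edges pk4 \<longleftrightarrow> u < 28 \<and> v \<in> set (pk4_nbrs u)"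
  using pk4_nbrs_check by (auto simp: pk4_def doubleton_eq_iff)

lemma pk4_cycles:
  assumes "k \<in> {0, 9, 18}"
  shows "cycle_in (edges pk4) (map (pk4_shift k) pk4_cycle)"
proof -
  have "cycle_in (edges pk4) (map (pk4_shift 0) pk4_cycle) \<and>
    cycle_in (edges pk4) (map (pk4_shift 9) pk4_cycle) \<and>
    cycle_in (edges pk4) (map (pk4_shift 18) pk4_cycle)"
    by (simp add: cycle_in_def pk4_cycle_def pk4_shift_def)
      (simp add: pk4_edge_iff pk4_nbrs_def pk4_shift_def)
  then show ?thesis using assms by auto
qed

text \<open>Zipping with the rotation yields the consecutive pairs together with the closing one, in
  a form that the simplifier can evaluate.\<close>

definition cyclically_adjacent :: "'a list \<Rightarrow> 'a \<Rightarrow> 'a \<Rightarrow> bool" where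
  "cyclically_adjacent xs u v \<longleftrightarrow>
    (u, v) \<in> set (zip xs (rotate1 xs)) \<or> (v, u) \<in> set (zip xs (rotate1 xs))"

lemma pk4_cycle_cover:
  assumes "u < 28" and "v \<in> set (pk4_nbrs u)"
  shows "\<exists>k\<in>{0, 9, 18}. cyclically_adjacent (map (pk4_shift k) pk4_cycle) u v"
proof -
  have "\<forall>u<28. \<forall>v\<in>set (pk4_nbrs u).
      \<exists>k\<in>{0, 9, 18}. cyclically_adjacent (map (pk4_shift k) pk4_cycle) u v"
    unfolding all_less_28 by (simp add: pk4_nbrs_def pk4_shift_def)
      (simp add: cyclically_adjacent_def pk4_cycle_def pk4_shift_def)
  then show ?thesis using assms by blast
qed

lemma pk4_edgeE:
  assumes "e \<in> edges pk4"
  obtains u v where "e = {u, v}" "u < 28" "v < 28" "u \<noteq> v" "v \<in> set (pk4_nbrs u)"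
proof -
  obtain u v where "e = {u, v}" "u < 28" "v \<in> set (pk4_nbrs u)" using assms by (auto simp: pk4_def)
  moreover from this have "v < 28" "v \<noteq> u" using pk4_nbrs_check[of u] by blast+
  ultimately show thesis by (intro that[of u v]) simp_all
qed

lemma pk4_incident:
  assumes "u < 28"
  shows "incident_edges pk4 u = (\<lambda>v. {u, v}) ` set (pk4_nbrs u)"
proof
  show "(\<lambda>v. {u, v}) ` set (pk4_nbrs u) \<subseteq> incident_edges pk4 u"
    using assms by (auto simp: incident_edges_def pk4_edge_iff)
  show "incident_edges pk4 u \<subseteq> (\<lambda>v. {u, v}) ` set (pk4_nbrs u)"
  proof
    fix e assume "e \<in> incident_edges pk4 u"
    then have e: "e \<in> edges pk4" "u \<in> e" by (auto simp: incident_edges_def)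
    from e(1) obtain x y where "e = {x, y}" by (rule pk4_edgeE)
    then obtain v where "e = {u, v}" using e(2) by blast
    then show "e \<in> (\<lambda>v. {u, v}) ` set (pk4_nbrs u)" using e(1) by (simp add: pk4_edge_iff)
  qed
qed

lemma verts_pk4: "verts pk4 = {..<28}"
  by (simp add: pk4_def)

lemma simple_graph_pk4: "simple_graph pk4"
proof -
  have "e \<subseteq> verts pk4 \<and> card e = 2" if "e \<in> edges pk4" for e
    using that by (rule pk4_edgeE) (auto simp: verts_pk4)
  then show ?thesis by (simp add: simple_graph_def verts_pk4)
qed

lemma cubic_pk4: "cubic pk4"
  unfolding cubic_def
proof
  fix u assume "u \<in> verts pk4"
  then have u: "u < 28" by (simp add: verts_pk4)
  have "inj_on (\<lambda>v. {u, v}) (set (pk4_nbrs u))" by (auto simp: inj_on_def doubleton_eq_iff)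
  then show "degree pk4 u = 3" using u pk4_nbrs_check[OF u]
    by (simp add: degree_def pk4_incident card_image distinct_card)
qed

section \<open>Detours along cycles\<close>

lemma cycle_in_rotate1:
  assumes "cycle_in E xs"
  shows "cycle_in E (rotate1 xs)"
proof -
  obtain x y z ws where "xs = x # y # z # ws"
    using assms by (auto simp: cycle_in_def numeral_3_eq_3 Suc_le_length_iff)
  then obtain zs where "xs = x # zs" "zs \<noteq> []" by blast
  then show ?thesis
    using assms by (auto simp: cycle_in_def successively_append_iff successively_Cons hd_append)
qed

lemma cycle_in_rotate: "cycle_in E xs \<Longrightarrow> cycle_in E (rotate n xs)"
  by (induction n) (simp_all add: cycle_in_rotate1)

text \<open>The detour is the cycle without its closing edge. Its later edges avoid
  \<open>hd xs\<close> by distinctness, and its first edge does not end in \<open>last xs\<close>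
  because the length is at least 3.\<close>

lemma cycle_in_detour:
  assumes "cycle_in E xs"
  shows "(hd xs, last xs) \<in> {(x, y). {x, y} \<in> E - {{hd xs, last xs}}}\<^sup>*"
proof -
  obtain x y z ws where "xs = x # y # z # ws"
    using assms by (auto simp: cycle_in_def numeral_3_eq_3 Suc_le_length_iff)
  then obtain zs where xs: "xs = x # y # zs" "zs \<noteq> []" by blast
  have dist: "x \<noteq> y" "x \<notin> set (y # zs)" "y \<noteq> last zs" "x \<noteq> last zs"
    using assms xs last_in_set[of zs] by (auto simp: cycle_in_def)
  let ?R = "{(x, y). {x, y} \<in> E - {{hd xs, last xs}}}"
  have "successively (\<lambda>x y. {x, y} \<in> E) (y # zs)" and xy: "{x, y} \<in> E"
    using assms xs by (auto simp: cycle_in_def successively_append_iff successively_Cons)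
  then have "successively (\<lambda>x y. {x, y} \<in> E - {{hd xs, last xs}}) (y # zs)"
    using dist(2) xs(1) by (elim successively_mono) (auto simp: doubleton_eq_iff)
  from successively_rtrancl[OF this] have "(y, last xs) \<in> ?R\<^sup>*" using xs by simp
  moreover have "(x, y) \<in> ?R" using xy dist xs by (auto simp: doubleton_eq_iff)
  ultimately show ?thesis using xs by (simp add: converse_rtrancl_into_rtrancl)
qed

text \<open>A rotation turns the given edge into the closing edge of the cycle, where
  \<open>cycle_in_detour\<close> applies.\<close>

lemma cyclically_adjacent_detour:
  assumes "cycle_in E xs" and "cyclically_adjacent xs u v"
  shows "\<exists>x y. {u, v} = {x, y} \<and> (x, y) \<in> {(x, y). {x, y} \<in> E - {{u, v}}}\<^sup>*"
proof -
  obtain i where i: "i < length xs" "{u, v} = {xs ! i, rotate1 xs ! i}"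
    using assms(2) by (auto simp: cyclically_adjacent_def set_zip)
  \<comment> \<open>One extra rotation puts the entry with index \<open>i\<close> last and its
    successor first.\<close>
  let ?ys = "rotate i (rotate1 xs)"
  have "hd ?ys = rotate1 xs ! i" using i(1) by (subst hd_rotate_conv_nth) auto
  moreover have "last ?ys = xs ! i"
  proof -
    have "last (rotate1 zs) = hd zs" if "zs \<noteq> []" for zs :: "'a list" using that by (cases zs) auto
    moreover have xs: "xs \<noteq> []" using i(1) by auto
    ultimately have "last (rotate1 (rotate i xs)) = hd (rotate i xs)" by simp
    then show ?thesis using i(1) hd_rotate_conv_nth[OF xs, of i] by (simp add: rotate1_rotate_swap)
  qed
  ultimately have uv: "{u, v} = {hd ?ys, last ?ys}" using i(2) by (simp only: insert_commute)
  have "cycle_in E ?ys" using assms(1) by (intro cycle_in_rotate cycle_in_rotate1)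
  from cycle_in_detour[OF this] show ?thesis unfolding uv by blast
qed

lemma bridgeless_pk4: "bridgeless pk4"
proof (rule bridgelessI)
  fix e assume "e \<in> edges pk4"
  then obtain u v where e: "e = {u, v}" "u < 28" "v \<in> set (pk4_nbrs u)" by (rule pk4_edgeE)
  from pk4_cycle_cover[OF e(2,3)] obtain k
    where "k \<in> {0, 9, 18}" "cyclically_adjacent (map (pk4_shift k) pk4_cycle) u v" by blast
  then show "\<exists>u v. e = {u, v} \<and> (u, v) \<in> {(x, y). {x, y} \<in> edges pk4 - {e}}\<^sup>*"
    using cyclically_adjacent_detour[OF pk4_cycles] e(1) by simp
qed

text \<open>
  Edges of the outer pentagon: \<open>a, \<dots>, e\<close>; spokes: \<open>s0, \<dots>, s4\<close>; inner edges: \<open>i0, i1, i2\<close>. The edges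
  \<open>s4, p, q\<close> are those that led to the deleted vertex.
\<close>

lemma petersen_minus_vertex_not_colourable:
  fixes a b c d e s0 s1 s2 s3 s4 i0 i1 i2 p q :: nat
  assumes "{a, b, c, d, e, s0, s1, s2, s3, s4, i0, i1, i2, p, q} \<subseteq> {1..3}"
    and "distinct [a, e, s0]" "distinct [a, b, s1]" "distinct [b, c, s2]" "distinct [c, d, s3]"
    and "distinct [e, d, s4]" "distinct [s0, i0, i1]" "distinct [s1, i2, p]" "distinct [s2, i0, q]"
    and "distinct [s3, i1, i2]"
  shows False
  \<comment> \<open>Each colour covers all nine vertices, an odd number, so it occurs an odd number
    of times among \<open>s4\<close>, \<open>p\<close>, \<open>q\<close>. These would thus have
    distinct colours and extend to a colouring of the Petersen graph, which has none. The solver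
    settles the finite case analysis directly.\<close>
  using assms
  by simp (smt (verit) One_nat_def Suc_1 le_SucE le_antisym numeral_3_eq_3)

text \<open>Without a conflict, the colours at a copy would be a proper colouring of the Petersen
  graph minus a vertex, dangling edges included.\<close>

lemma pk4_copy_conflict:
  assumes c: "edge_assignment3 pk4 c" and k: "k \<in> {0, 9, 18}"
  shows "\<exists>v\<in>{k..<k + 9}. conflicting pk4 c v"
proof (rule ccontr)
  assume no: "\<not> ?thesis"
  define f where "f u v = c {u, v}" for u v
  have sym: "f u v = f v u" for u v by (simp add: f_def insert_commute)
  have f: "distinct (map (f v) (pk4_nbrs v))" "f v ` set (pk4_nbrs v) \<subseteq> {1..3}"
    if "v \<in> {k..<k + 9}" for v
  proof -
    have v: "v < 28" using that k by auto
    have "\<not> conflicting pk4 c v" using no that by blast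
    then have "inj_on c ((\<lambda>w. {v, w}) ` set (pk4_nbrs v))"
      by (simp add: conflicting_def pk4_incident[OF v])
    moreover have "inj_on (\<lambda>w. {v, w}) (set (pk4_nbrs v))"
      by (auto simp: inj_on_def doubleton_eq_iff)
    ultimately have "inj_on (c \<circ> (\<lambda>w. {v, w})) (set (pk4_nbrs v))" by (rule comp_inj_on[rotated])
    moreover have "c \<circ> (\<lambda>w. {v, w}) = f v" by (simp add: f_def fun_eq_iff)
    ultimately have "inj_on (f v) (set (pk4_nbrs v))" by (simp only:)
    then show "distinct (map (f v) (pk4_nbrs v))"
      using pk4_nbrs_check[OF v] by (simp add: distinct_map)
    show "f v ` set (pk4_nbrs v) \<subseteq> {1..3}"
      using c v by (auto simp: edge_assignment3_def f_def pk4_edge_iff)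
  qed
  have nb: "pk4_nbrs (k + j) = map (pk4_shift k) ([[1, 4, 5], [0, 2, 6], [1, 3, 7], [2, 4, 8],
      [0, 3, 27], [0, 7, 8], [1, 8, 16], [2, 5, 24], [3, 5, 6]] ! j)" if "j < 9" for j
  proof -
    have "9 dvd k" using k by auto
    then have "(k + j) mod 9 = j" "9 * ((k + j) div 9) = k" using that by auto
    moreover have "k + j \<noteq> 27" using k that by auto
    ultimately show ?thesis by (simp only: pk4_nbrs_def if_False)
  qed
  have sh: "pk4_shift k j = k + j" if "j < 9" for j using k that by (auto simp: pk4_shift_def)
  \<comment> \<open>\<open>g\<close> uses indices local to the copy. Here \<open>27\<close>,
    \<open>16\<close> and \<open>24\<close> lie outside it and name the far ends of the three
    dangling edges, so symmetry is stated for indices below 9 only.\<close>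
  define g where "g i j = f (k + i) (pk4_shift k j)" for i j
  have gsym: "g i j = g j i" if "i < 9" "j < 9" for i j
    using that sym by (simp add: g_def sh)
  have G: "distinct (map (g j) (xs j))" "g j ` set (xs j) \<subseteq> {1..3}"
     if "j < 9" "xs = (!) [[1, 4, 5], [0, 2, 6], [1, 3, 7], [2, 4, 8],
      [0, 3, 27], [0, 7, 8], [1, 8, 16], [2, 5, 24], [3, 5, 6]]" for j xs
  proof -
    have "map (g j) (xs j) = map (f (k + j)) (pk4_nbrs (k + j))"
      unfolding nb[OF that(1)] that(2) by (simp add: g_def)
    moreover have "g j ` set (xs j) = f (k + j) ` set (pk4_nbrs (k + j))"
      unfolding nb[OF that(1)] that(2) by (simp add: g_def image_image)
    ultimately show "distinct (map (g j) (xs j))" "g j ` set (xs j) \<subseteq> {1..3}"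
      using f[of "k + j"] that(1) by simp_all
  qed
  note G' = G[OF _ refl]
  show False
    using G'[of 0] G'[of 1] G'[of 2] G'[of 3] G'[of 4] G'[of 5] G'[of 6] G'[of 7] G'[of 8]
    by (intro petersen_minus_vertex_not_colourable[of "g 0 1" "g 1 2" "g 2 3" "g 3 4" "g 0 4" "g 0 5"
        "g 1 6" "g 2 7" "g 3 8" "g 4 27" "g 5 7" "g 5 8" "g 6 8" "g 6 16" "g 7 24"])
      (simp_all add: gsym[of "Suc 0" 0] gsym[of 2 "Suc 0"] gsym[of 3 2] gsym[of 4 3] gsym[of 4 0] gsym[of 5 0]
        gsym[of 6 "Suc 0"] gsym[of 7 2] gsym[of 8 3] gsym[of 7 5] gsym[of 8 5] gsym[of 8 6])
qed

lemma colouring_degree_pk4: "colouring_degree pk4 = 3"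
proof -
  \<comment> \<open>An edge is an unordered pair, so \<open>Min\<close> and \<open>Max\<close> fix
    an order; on edges \<open>pk4_col\<close> is symmetric, which makes the order
    immaterial.\<close>
  define c where "c e = pk4_col (Min e) (Max e)" for e
  have c: "c {u, v} = pk4_col u v" if "u < 28" "v \<in> set (pk4_nbrs u)" for u v
  proof -
    have "pk4_col u v = pk4_col v u" using that pk4_col_check[of u] by blast
    then show ?thesis by (cases "u \<le> v") (simp_all add: c_def min_def max_def)
  qed
  have as: "edge_assignment3 pk4 c"
    unfolding edge_assignment3_def
  proof
    fix e assume "e \<in> edges pk4"
    then obtain u v where "e = {u, v}" "u < 28" "v \<in> set (pk4_nbrs u)" by (rule pk4_edgeE)
    then show "c e \<in> {1..3}" using pk4_col_check[of u] c[of u v] by auto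
  qed
  have "\<not> conflicting pk4 c u" if u: "u < 28" "u \<notin> {0, 9, 18}" for u
  proof -
    have "distinct (map (pk4_col u) (pk4_nbrs u))" using u pk4_col_check[of u] by blast
    then have "inj_on (pk4_col u) (set (pk4_nbrs u))" by (simp add: distinct_map)
    then have "inj_on (\<lambda>v. c {u, v}) (set (pk4_nbrs u))"
      using c u(1) inj_on_cong[of "set (pk4_nbrs u)" "\<lambda>v. c {u, v}" "pk4_col u"] by simp
    then have "inj_on c ((\<lambda>v. {u, v}) ` set (pk4_nbrs u))"
      by (intro inj_on_imageI) (simp add: comp_def)
    then show ?thesis using u by (simp add: conflicting_def pk4_incident)
  qed
  then have "{v \<in> verts pk4. conflicting pk4 c v} \<subseteq> {0, 9, 18}" by (auto simp: verts_pk4)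
  from card_mono[OF _ this] have le: "card {v \<in> verts pk4. conflicting pk4 c v} \<le> 3" by simp
  have ge: "3 \<le> card {v \<in> verts pk4. conflicting pk4 c v}" if c: "edge_assignment3 pk4 c" for c
  proof -
    \<comment> \<open>The three copies are disjoint, so their conflicts are three different
      vertices.\<close>
    obtain x y z where v: "x \<in> {0..<0 + 9}" "conflicting pk4 c x" "y \<in> {9..<9 + 9}"
        "conflicting pk4 c y" "z \<in> {18..<18 + 9}" "conflicting pk4 c z"
      using pk4_copy_conflict[OF c, of 0] pk4_copy_conflict[OF c, of 9] pk4_copy_conflict[OF c, of 18]
      by blast
    have "x \<noteq> y" "x \<noteq> z" "y \<noteq> z" using v(1,3,5) by auto
    then have "3 = card {x, y, z}" by simp
    also have "\<dots> \<le> card {v \<in> verts pk4. conflicting pk4 c v}"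
      using v by (intro card_mono) (auto simp: verts_pk4)
    finally show ?thesis .
  qed
  show ?thesis
    unfolding colouring_degree_def
  proof (rule Least_equality)
    show "\<exists>c. edge_assignment3 pk4 c \<and> card {v \<in> verts pk4. conflicting pk4 c v} = 3"
      using as le ge[OF as] by (intro exI[of _ c]) simp
  qed (use ge in auto)
qed

theorem theorem5p5:
  "(\<forall>Q :: 'a ugraph. simple_graph Q \<and> cubic Q \<longrightarrow>
      delta3 Q = int (colouring_degree Q)) \<and>
   (\<forall>G :: 'a ugraph. simple_graph G \<and> subcubic G \<longrightarrow>
      colouring_degree G = resistance G \<and> resistance G = vertex_resistance G) \<and>
   (\<forall>Q :: 'a ugraph. simple_graph Q \<and> cubic Q \<longrightarrow>
      delta3 Q = int (colouring_degree Q) \<and>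
      colouring_degree Q = resistance Q \<and> resistance Q = vertex_resistance Q) \<and>
   (\<exists>G :: nat ugraph. simple_graph G \<and> cubic G \<and> bridgeless G \<and>
      int (weak_oddness G) \<noteq> delta3 G \<and> weak_oddness G \<noteq> colouring_degree G \<and>
      weak_oddness G \<noteq> resistance G \<and> weak_oddness G \<noteq> vertex_resistance G)"
proof (intro conjI allI impI)
  fix Q :: "'a ugraph" assume Q: "simple_graph Q \<and> cubic Q"
  then have "subcubic Q" by (simp add: cubic_def subcubic_def)
  then show "delta3 Q = int (colouring_degree Q)" "delta3 Q = int (colouring_degree Q)"
    "colouring_degree Q = resistance Q" "resistance Q = vertex_resistance Q"
    using Q delta3_eq_colouring_degree resistance_equalities by blast+
next
  fix G :: "'a ugraph" assume "simple_graph G \<and> subcubic G"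
  then show "colouring_degree G = resistance G" "resistance G = vertex_resistance G"
    using resistance_equalities by blast+
next
  have "subcubic pk4" using cubic_pk4 by (simp add: cubic_def subcubic_def)
  note eqs = delta3_eq_colouring_degree[OF simple_graph_pk4 cubic_pk4]
    resistance_equalities[OF simple_graph_pk4 this]
  \<comment> \<open>Weak oddness is even on 28 vertices, while the other parameters all equal
    3.\<close>
  have "even (weak_oddness pk4)"
    using simple_graph_pk4 by (intro even_weak_oddness) (simp_all add: verts_pk4)
  then have "weak_oddness pk4 \<noteq> 3" by auto
  then show "\<exists>G :: nat ugraph. simple_graph G \<and> cubic G \<and> bridgeless G \<and>
      int (weak_oddness G) \<noteq> delta3 G \<and> weak_oddness G \<noteq> colouring_degree G \<and>
      weak_oddness G \<noteq> resistance G \<and> weak_oddness G \<noteq> vertex_resistance G"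
    using simple_graph_pk4 cubic_pk4 bridgeless_pk4 eqs colouring_degree_pk4
    by (intro exI[of _ pk4]) simp
qed

end
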